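(* Let $\mathfrak{S}$ be a faithful cartesian club, $\mathcal{M}$ an $\mathfrak{S}$-multicategory, and $(A,\bullet)$ an $\mathfrak{S}$-combinatory complete applicative system in $\mathcal{M}$. Then $(A,\bullet)$ is multi-extensional if and only if the sub-multicategory of $\mathcal{M}$ consisting of the $(A,\bullet)$-computable morphisms (with single object $A$) is a closed multicategory with $[A,A]=A$ and $\mathsf{ev}_{A,A}=\bullet$.
   Context: Clubs. $\mathbf{Fun}$ is the category with objects the natural numbers and morphisms $n\to m$ the functions $\underline{n}\to\underline{m}$, where $\underline{n}=\{1,\ldots,n\}$. For $\mathbf{a}:n\to m$, $\mathbf{b}:h\to k$, $\mathbf{a}+\mathbf{b}:n+h\to m+k$ is $x\mapsto\mathbf{a}(x)$ for $x\le n$ and $x\mapsto\mathbf{b}(x-n)+m$ for $x>n$. For $\mathbf{a}:m\to n$ and $k_1,\ldots,k_n\in\mathbb{N}$, the wreath product $\mathbf{a}\wr(k_1,\ldots,k_n):\sum_{j=1}^m k_{\mathbf{a}(j)}\to\sum_{i=1}^n k_i$ sends the $p$-th element of the $j$-th block (of size $k_{\mathbf{a}(j)}$) to the $p$-th element of the $\mathbf{a}(j)$-th block. A faithful cartesian club is a subcategory $\mathfrak{S}$ of $\mathbf{Fun}$ containing all objects and closed under $+$ and under $\mathbf{a}\mapsto\mathbf{a}\wr(k_1,\ldots,k_n)$ for all $k_i$. Multicategories. A multicategory $\mathcal{M}$ has objects $\mathcal{M}_0$, morphism sets $\mathcal{M}(A_1,\ldots,A_n;B)$ ($n\ge 0$),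 identities $1_A\in\mathcal{M}(A;A)$, and associative unital composition sending $f\in\mathcal{M}(A_1,\ldots,A_n;B)$, $g_i\in\mathcal{M}(\Gamma_i;A_i)$ to $f\circ(g_1,\ldots,g_n)\in\mathcal{M}(\Gamma_1,\ldots,\Gamma_n;B)$. $A^n$ (resp. $f^n$) means $n$ copies of $A$ (resp. $f$). An $\mathfrak{S}$-multicategory is a multicategory with operations $[-]\mathbf{a}:\mathcal{M}(A_{\mathbf{a}(1)},\ldots,A_{\mathbf{a}(m)};B)\to\mathcal{M}(A_1,\ldots,A_n;B)$ for each $\mathbf{a}:m\to n$ in $\mathfrak{S}$, such that $[[f]\mathbf{a}]\mathbf{b}=[f](\mathbf{b}\circ\mathbf{a})$; $[f]1=f$; $g\circ([f_1]\mathbf{a}_1,\ldots,[f_n]\mathbf{a}_n)=[g\circ(f_1,\ldots,f_n)](\mathbf{a}_1+\cdots+\mathbf{a}_n)$; and $[g]\mathbf{a}\circ(f_1,\ldots,f_n)=[g\circ(f_{\mathbf{a}(1)},\ldots,f_{\mathbf{a}(m)})](\mathbf{a}\wr(k_1,\ldots,k_n))$ where $k_i$ is the arity of $f_i$. A sub-$\mathfrak{S}$-multicategory is given by subcollections of objects and of morphisms containing identities and closed under composition and under the action of $\mathfrak{S}$. A closed multicategory is a multicategory $\mathcal{M}$ with, for all objects $A,B$, an object $[A,B]$ and a morphism $\mathsf{ev}_{A,B}\in\mathcal{M}([A,B],A;B)$ such that for every finite sequence $\Gamma$ of objects and every $f\in\mathcal{M}(\Gamma,A;B)$ there is a unique $h\in\mathcal{M}(\Gamma;[A,B])$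 with $\mathsf{ev}_{A,B}\circ(h,1_A)=f$. Applicative systems. An applicative system $(A,\bullet)$ in $\mathcal{M}$ is an object $A$ with $\bullet\in\mathcal{M}(A,A;A)$. Put $\bullet^0=1_A$, $\bullet^{n+1}=\bullet\circ(\bullet^n,1_A)\in\mathcal{M}(A,A^{n+1};A)$. $f\in\mathcal{M}(A^n;A)$ is $(A,\bullet)$-computable if $f=\bullet^n\circ(a,1_A^n)$ for some $a\in\mathcal{M}(;A)$. $(A,\bullet)$ is $\mathfrak{S}$-combinatory complete if every morphism of the smallest sub-$\mathfrak{S}$-multicategory of $\mathcal{M}$ containing $\bullet$ and all $a\in\mathcal{M}(;A)$ is $(A,\bullet)$-computable; in this case the $(A,\bullet)$-computable morphisms form a sub-$\mathfrak{S}$-multicategory of $\mathcal{M}$. $(A,\bullet)$ is multi-extensional if for all $n\in\mathbb{N}$ and $a,b\in\mathcal{M}(;A)$, $\bullet^n\circ(a,1_A^n)=\bullet^n\circ(b,1_A^n)$ implies $a=b$. *)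

theory Defs
  imports Main "HOL-Library.FuncSet"
begin

section \<open>The category Fun and faithful cartesian clubs\<close>

text \<open>
  Indices start at 0, to agree with list positions: the set with \<open>n\<close> elements is \<open>{..<n}\<close>, and the
  formulas for sums and wreath products are shifted accordingly.  A morphism carries its domain and
  codomain, and its underlying function is extensional, so that equal functions \<open>m \<rightarrow> n\<close> are equal records.
\<close>

record fmor =
  fdom :: nat
  fcod :: nat
  fapp :: "nat \<Rightarrow> nat"

definition Fun_mor :: "fmor set" where
  "Fun_mor = {a. fapp a \<in> {..<fdom a} \<rightarrow>\<^sub>E {..<fcod a}}"

definition fid :: "nat \<Rightarrow> fmor" where
  "fid n = \<lparr>fdom = n, fcod = n, fapp = (\<lambda>x\<in>{..<n}. x)\<rparr>"

definition fcomp :: "fmor \<Rightarrow> fmor \<Rightarrow> fmor" where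
  "fcomp b a = \<lparr>fdom = fdom a, fcod = fcod b, fapp = compose {..<fdom a} (fapp b) (fapp a)\<rparr>"

definition fplus :: "fmor \<Rightarrow> fmor \<Rightarrow> fmor" where
  "fplus a b = \<lparr>fdom = fdom a + fdom b, fcod = fcod a + fcod b,
     fapp = (\<lambda>x\<in>{..<fdom a + fdom b}. if x < fdom a then fapp a x else fapp b (x - fdom a) + fcod a)\<rparr>"

definition fsum :: "fmor list \<Rightarrow> fmor" where
  "fsum as = foldr fplus as (fid 0)"

text \<open>
  The element at offset \<open>p\<close> of block \<open>j\<close> (of size \<open>ks ! a j\<close>) goes to the element at offset \<open>p\<close> of
  block \<open>a j\<close>.  The description is well-defined by \<open>wreath_block\<close> below.
\<close>

definition wreath :: "fmor \<Rightarrow> nat list \<Rightarrow> fmor" where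
  "wreath a ks = \<lparr>fdom = (\<Sum>j<fdom a. ks ! fapp a j), fcod = sum_list ks,
     fapp = (\<lambda>x\<in>{..<\<Sum>j<fdom a. ks ! fapp a j}.
       THE y. \<exists>j<fdom a. \<exists>p<ks ! fapp a j.
         x = (\<Sum>i<j. ks ! fapp a i) + p \<and> y = (\<Sum>i<fapp a j. ks ! i) + p)\<rparr>"

lemma block_unique:
  fixes k :: "nat \<Rightarrow> nat"
  assumes "(\<Sum>i<j. k i) + p = (\<Sum>i<j'. k i) + p'" "p < k j" "p' < k j'"
  shows "j = j' \<and> p = p'"
proof -
  have less: False if "u < v" "(\<Sum>i<u. k i) + q = (\<Sum>i<v. k i) + q'" "q < k u" for u v q q'
  proof -
    have "(\<Sum>i<Suc u. k i) \<le> (\<Sum>i<v. k i)"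
      using that(1) by (intro sum_mono2) auto
    then show False using that by simp
  qed
  show ?thesis
    using less[of j j' p p'] less[of j' j p' p] assms by (cases j j' rule: linorder_cases) auto
qed

lemma wreath_block:
  assumes "j < fdom a" "p < ks ! fapp a j"
  shows "fapp (wreath a ks) ((\<Sum>i<j. ks ! fapp a i) + p) = (\<Sum>i<fapp a j. ks ! i) + p"
proof -
  have "(\<Sum>i<Suc j. ks ! fapp a i) \<le> (\<Sum>i<fdom a. ks ! fapp a i)"
    using assms(1) by (intro sum_mono2) auto
  then have "(\<Sum>i<j. ks ! fapp a i) + p < (\<Sum>i<fdom a. ks ! fapp a i)"
    using assms(2) by simp
  moreover have "(THE y. \<exists>j'<fdom a. \<exists>p'<ks ! fapp a j'.
      (\<Sum>i<j. ks ! fapp a i) + p = (\<Sum>i<j'. ks ! fapp a i) + p' \<and>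
      y = (\<Sum>i<fapp a j'. ks ! i) + p') = (\<Sum>i<fapp a j. ks ! i) + p"
    using assms by (intro the_equality) (auto dest: block_unique[where k = "\<lambda>i. ks ! fapp a i"])
  ultimately show ?thesis by (simp add: wreath_def)
qed

locale faithful_cartesian_club =
  fixes S :: "fmor set"
  assumes subset_Fun: "S \<subseteq> Fun_mor"
    and fid_closed: "fid n \<in> S"
    and fcomp_closed: "a \<in> S \<Longrightarrow> b \<in> S \<Longrightarrow> fcod a = fdom b \<Longrightarrow> fcomp b a \<in> S"
    and fplus_closed: "a \<in> S \<Longrightarrow> b \<in> S \<Longrightarrow> fplus a b \<in> S"
    and wreath_closed: "a \<in> S \<Longrightarrow> length ks = fcod a \<Longrightarrow> wreath a ks \<in> S"


section \<open>Multicategories\<close>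

text \<open>
  Every morphism determines its source (a list of objects) and its target, that is, the morphism
  sets are disjoint.  Operations are constrained only on arguments of the appropriate types.
\<close>

record ('o, 'm) mcat =
  Obj :: "'o set"
  Mor :: "'m set"
  src :: "'m \<Rightarrow> 'o list"
  tgt :: "'m \<Rightarrow> 'o"
  idn :: "'o \<Rightarrow> 'm"
  cmp :: "'m \<Rightarrow> 'm list \<Rightarrow> 'm"

definition hom :: "('o, 'm, 'x) mcat_scheme \<Rightarrow> 'o list \<Rightarrow> 'o \<Rightarrow> 'm set" where
  "hom M \<Gamma> B = {f \<in> Mor M. src M f = \<Gamma> \<and> tgt M f = B}"

definition composable :: "('o, 'm, 'x) mcat_scheme \<Rightarrow> 'm \<Rightarrow> 'm list \<Rightarrow> bool" where
  "composable M f gs \<longleftrightarrow> f \<in> Mor M \<and> set gs \<subseteq> Mor M \<and> map (tgt M) gs = src M f"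

locale multicategory =
  fixes M :: "('o, 'm, 'x) mcat_scheme"
  assumes src_Obj: "f \<in> Mor M \<Longrightarrow> set (src M f) \<subseteq> Obj M"
    and tgt_Obj: "f \<in> Mor M \<Longrightarrow> tgt M f \<in> Obj M"
    and idn_hom: "A \<in> Obj M \<Longrightarrow> idn M A \<in> hom M [A] A"
    and cmp_hom: "composable M f gs \<Longrightarrow> cmp M f gs \<in> hom M (concat (map (src M) gs)) (tgt M f)"
    and cmp_idn_right: "f \<in> Mor M \<Longrightarrow> cmp M f (map (idn M) (src M f)) = f"
    and cmp_idn_left: "f \<in> Mor M \<Longrightarrow> cmp M (idn M (tgt M f)) [f] = f"
    and cmp_assoc: "composable M f gs \<Longrightarrow> list_all2 (composable M) gs hss \<Longrightarrow>
      cmp M (cmp M f gs) (concat hss) = cmp M f (map2 (cmp M) gs hss)"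

text \<open>For \<open>a : m \<rightarrow> n\<close> and a list \<open>xs\<close> of length \<open>n\<close>, the list of the \<open>xs ! a j\<close> for \<open>j < m\<close>.\<close>

definition reindex :: "fmor \<Rightarrow> 'a list \<Rightarrow> 'a list" where
  "reindex a xs = map (\<lambda>j. xs ! fapp a j) [0..<fdom a]"

text \<open>
  \<open>act M a \<Delta> f\<close> is \<open>[f]a\<close>.  The list \<open>\<Delta>\<close> of source objects of the result is an argument, since
  it is not determined by \<open>f\<close> and \<open>a\<close> when \<open>a\<close> is not surjective.
\<close>

record ('o, 'm) smcat = "('o, 'm) mcat" +
  act :: "fmor \<Rightarrow> 'o list \<Rightarrow> 'm \<Rightarrow> 'm"

locale S_multicategory = faithful_cartesian_club S + multicategory M
  for S :: "fmor set" and M :: "('o, 'm, 'x) smcat_scheme" +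
  assumes act_hom:
      "a \<in> S \<Longrightarrow> length \<Delta> = fcod a \<Longrightarrow> set \<Delta> \<subseteq> Obj M \<Longrightarrow> f \<in> hom M (reindex a \<Delta>) B \<Longrightarrow>
        act M a \<Delta> f \<in> hom M \<Delta> B"
    and act_act:
      "a \<in> S \<Longrightarrow> b \<in> S \<Longrightarrow> fcod a = fdom b \<Longrightarrow> length \<Delta> = fcod b \<Longrightarrow> set \<Delta> \<subseteq> Obj M \<Longrightarrow>
        f \<in> hom M (reindex a (reindex b \<Delta>)) B \<Longrightarrow>
        act M b \<Delta> (act M a (reindex b \<Delta>) f) = act M (fcomp b a) \<Delta> f"
    and act_fid:
      "f \<in> Mor M \<Longrightarrow> act M (fid (length (src M f))) (src M f) f = f"
    and cmp_act_right:
      "g \<in> Mor M \<Longrightarrow> length (src M g) = n \<Longrightarrow> length as = n \<Longrightarrow> length \<Delta>s = n \<Longrightarrow> length fs = n \<Longrightarrow>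
        (\<And>i. i < n \<Longrightarrow> as ! i \<in> S \<and> length (\<Delta>s ! i) = fcod (as ! i) \<and> set (\<Delta>s ! i) \<subseteq> Obj M \<and>
          fs ! i \<in> hom M (reindex (as ! i) (\<Delta>s ! i)) (src M g ! i)) \<Longrightarrow>
        cmp M g (map (\<lambda>i. act M (as ! i) (\<Delta>s ! i) (fs ! i)) [0..<n]) =
        act M (fsum as) (concat \<Delta>s) (cmp M g fs)"
    and cmp_act_left:
      "a \<in> S \<Longrightarrow> length fs = fcod a \<Longrightarrow> set fs \<subseteq> Mor M \<Longrightarrow>
        g \<in> hom M (reindex a (map (tgt M) fs)) B \<Longrightarrow>
        cmp M (act M a (map (tgt M) fs) g) fs =
        act M (wreath a (map (\<lambda>f. length (src M f)) fs)) (concat (map (src M) fs))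
          (cmp M g (reindex a fs))"

definition sub_S_multicategory ::
    "fmor set \<Rightarrow> ('o, 'm, 'x) smcat_scheme \<Rightarrow> 'o set \<Rightarrow> 'm set \<Rightarrow> bool" where
  "sub_S_multicategory S M X F \<longleftrightarrow>
    X \<subseteq> Obj M \<and> F \<subseteq> Mor M \<and>
    (\<forall>f\<in>F. set (src M f) \<subseteq> X \<and> tgt M f \<in> X) \<and>
    (\<forall>B\<in>X. idn M B \<in> F) \<and>
    (\<forall>f gs. composable M f gs \<longrightarrow> f \<in> F \<longrightarrow> set gs \<subseteq> F \<longrightarrow> cmp M f gs \<in> F) \<and>
    (\<forall>a\<in>S. \<forall>\<Delta>. \<forall>f\<in>F. length \<Delta> = fcod a \<longrightarrow> set \<Delta> \<subseteq> X \<longrightarrow> src M f = reindex a \<Delta> \<longrightarrow>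
      act M a \<Delta> f \<in> F)"

locale closed_multicategory = multicategory M
  for M :: "('o, 'm, 'x) mcat_scheme" +
  fixes ihom :: "'o \<Rightarrow> 'o \<Rightarrow> 'o" and ev :: "'o \<Rightarrow> 'o \<Rightarrow> 'm"
  assumes ihom_Obj: "A \<in> Obj M \<Longrightarrow> B \<in> Obj M \<Longrightarrow> ihom A B \<in> Obj M"
    and ev_hom: "A \<in> Obj M \<Longrightarrow> B \<in> Obj M \<Longrightarrow> ev A B \<in> hom M [ihom A B, A] B"
    and ev_universal: "A \<in> Obj M \<Longrightarrow> B \<in> Obj M \<Longrightarrow> set \<Gamma> \<subseteq> Obj M \<Longrightarrow> f \<in> hom M (\<Gamma> @ [A]) B \<Longrightarrow>
      \<exists>!h. h \<in> hom M \<Gamma> (ihom A B) \<and> cmp M (ev A B) [h, idn M A] = f"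


section \<open>Applicative systems\<close>

definition applicative_system :: "('o, 'm, 'x) mcat_scheme \<Rightarrow> 'o \<Rightarrow> 'm \<Rightarrow> bool" where
  "applicative_system M A app \<longleftrightarrow> A \<in> Obj M \<and> app \<in> hom M [A, A] A"

primrec app_pow :: "('o, 'm, 'x) mcat_scheme \<Rightarrow> 'o \<Rightarrow> 'm \<Rightarrow> nat \<Rightarrow> 'm" where
  "app_pow M A app 0 = idn M A"
| "app_pow M A app (Suc n) = cmp M app [app_pow M A app n, idn M A]"

definition app_element :: "('o, 'm, 'x) mcat_scheme \<Rightarrow> 'o \<Rightarrow> 'm \<Rightarrow> nat \<Rightarrow> 'm \<Rightarrow> 'm" where
  "app_element M A app n a = cmp M (app_pow M A app n) (a # replicate n (idn M A))"

definition computable :: "('o, 'm, 'x) mcat_scheme \<Rightarrow> 'o \<Rightarrow> 'm \<Rightarrow> 'm set" where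
  "computable M A app =
    {f. \<exists>n. f \<in> hom M (replicate n A) A \<and> (\<exists>a \<in> hom M [] A. f = app_element M A app n a)}"

text \<open>
  The morphisms of the smallest sub-multicategory containing \<open>app\<close> and all \<open>a \<in> hom M [] A\<close>:
  sub-multicategories are closed under componentwise intersection.
\<close>

definition generated :: "fmor set \<Rightarrow> ('o, 'm, 'x) smcat_scheme \<Rightarrow> 'o \<Rightarrow> 'm \<Rightarrow> 'm set" where
  "generated S M A app =
    \<Inter>{F. \<exists>X. sub_S_multicategory S M X F \<and> app \<in> F \<and> hom M [] A \<subseteq> F}"

definition combinatory_complete ::
    "fmor set \<Rightarrow> ('o, 'm, 'x) smcat_scheme \<Rightarrow> 'o \<Rightarrow> 'm \<Rightarrow> bool" where
  "combinatory_complete S M A app \<longleftrightarrow> generated S M A app \<subseteq> computable M A app"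

definition multi_extensional :: "('o, 'm, 'x) mcat_scheme \<Rightarrow> 'o \<Rightarrow> 'm \<Rightarrow> bool" where
  "multi_extensional M A app \<longleftrightarrow>
    (\<forall>n. \<forall>a \<in> hom M [] A. \<forall>b \<in> hom M [] A.
      app_element M A app n a = app_element M A app n b \<longrightarrow> a = b)"

definition computable_mcat :: "('o, 'm, 'x) mcat_scheme \<Rightarrow> 'o \<Rightarrow> 'm \<Rightarrow> ('o, 'm) mcat" where
  "computable_mcat M A app =
    \<lparr>Obj = {A}, Mor = computable M A app, src = src M, tgt = tgt M, idn = idn M, cmp = cmp M\<rparr>"

end

(* The identity app_element (n + 1) a = app o (app_element n a, 1), an instance of associativity, says
   that a code of an (n + 1)-ary computable morphism is also a code of its n-ary transpose.  So
   transposes of computable morphisms always exist, and uniqueness of transposes amounts to uniqueness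
   of codes, by descending on the arity to the 0-ary case, where every element is its own code.
   Combinatory completeness only serves to make the computable morphisms a multicategory. *)

theory Submission
  imports Defs
begin

text \<open>Codes and transposes involve composition and identities alone, hence a bare
  multicategory as setting. The action of \<open>S\<close> enters later, through
  \<open>generated\<close>.\<close>

locale applicative = multicategory M
  for M :: "('o, 'm, 'x) mcat_scheme" +
  fixes A :: 'o and app :: 'm
  assumes applicative_system: "applicative_system M A app"
begin

lemma A_Obj: "A \<in> Obj M"
  and app_hom: "app \<in> hom M [A, A] A"
  using applicative_system by (auto simp: applicative_system_def)

lemma idn_A: "idn M A \<in> Mor M" "src M (idn M A) = [A]" "tgt M (idn M A) = A"
  using idn_hom[OF A_Obj] by (auto simp: hom_def)

lemma concat_src_replicate_idn:
  "concat (map (src M) (replicate n (idn M A))) = replicate n A"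
  by (induction n) (auto simp: idn_A)

lemma app_composable:
  assumes "f \<in> hom M \<Gamma> A"
  shows "composable M app [f, idn M A]"
  using assms app_hom idn_A by (auto simp: composable_def hom_def)

lemma app_cmp_hom:
  assumes "f \<in> hom M \<Gamma> A"
  shows "cmp M app [f, idn M A] \<in> hom M (\<Gamma> @ [A]) A"
  using cmp_hom[OF app_composable[OF assms]] assms app_hom idn_A by (auto simp: hom_def)

lemma app_pow_hom: "app_pow M A app n \<in> hom M (replicate (Suc n) A) A"
proof (induction n)
  case 0
  then show ?case using idn_hom[OF A_Obj] by simp
next
  case (Suc n)
  from app_cmp_hom[OF this] show ?case by (simp add: replicate_append_same)
qed

lemma app_element_composable:
  assumes "a \<in> hom M [] A"
  shows "composable M (app_pow M A app n) (a # replicate n (idn M A))"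
  using assms app_pow_hom[of n] idn_A by (auto simp: composable_def hom_def)

lemma app_element_hom:
  assumes "a \<in> hom M [] A"
  shows "app_element M A app n a \<in> hom M (replicate n A) A"
  using cmp_hom[OF app_element_composable[OF assms, of n]] assms app_pow_hom[of n]
    concat_src_replicate_idn[of n]
  by (auto simp: app_element_def hom_def)

lemma app_element_0:
  assumes "a \<in> hom M [] A"
  shows "app_element M A app 0 a = a"
  using assms cmp_idn_left[of a] by (auto simp: app_element_def hom_def)

lemma app_element_Suc:
  assumes "a \<in> hom M [] A"
  shows "app_element M A app (Suc n) a = cmp M app [app_element M A app n a, idn M A]"
proof -
  \<comment> \<open>The inputs \<open>a, 1, ..., 1\<close> are cut into two blocks, one for each
    input of the outer \<open>app\<close>: \<open>a\<close> with \<open>n\<close> identities goes to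
    \<open>app_pow M A app n\<close>, the last identity to \<open>idn M A\<close>.\<close>
  let ?hss = "[a # replicate n (idn M A), [idn M A]]"
  have "list_all2 (composable M) [app_pow M A app n, idn M A] ?hss"
    using app_element_composable[OF assms, of n] idn_A by (simp add: composable_def)
  from cmp_assoc[OF app_composable[OF app_pow_hom] this]
  have "cmp M (app_pow M A app (Suc n)) (concat ?hss) =
      cmp M app [app_element M A app n a, cmp M (idn M A) [idn M A]]"
    by (simp add: app_element_def)
  moreover have "cmp M (idn M A) [idn M A] = idn M A"
    using cmp_idn_left[of "idn M A"] idn_A by simp
  moreover have "concat ?hss = a # replicate (Suc n) (idn M A)"
    by (simp add: replicate_append_same)
  ultimately show ?thesis
    by (simp only: app_element_def)
qed

lemma app_element_computable:
  assumes "a \<in> hom M [] A"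
  shows "app_element M A app n a \<in> computable M A app"
  using app_element_hom[OF assms] assms by (auto simp: computable_def)

lemma computableE:
  assumes "f \<in> computable M A app"
  obtains n a where "a \<in> hom M [] A" "f = app_element M A app n a" "f \<in> hom M (replicate n A) A"
  using assms by (auto simp: computable_def)

text \<open>The arity hidden in \<open>computable\<close> can be read off the source, since
  \<open>replicate k A = \<Gamma>\<close> forces \<open>k = length \<Gamma>\<close>.\<close>

lemma computable_homE:
  assumes "f \<in> computable M A app" "f \<in> hom M \<Gamma> B" "length \<Gamma> = n"
  obtains a where "a \<in> hom M [] A" "f = app_element M A app n a"
  using assms by (auto simp: hom_def elim!: computableE)

abbreviation N :: "('o, 'm) mcat" where
  "N \<equiv> computable_mcat M A app"

lemma hom_computable_mcat:
  "hom N \<Gamma> B = hom M \<Gamma> B \<inter> computable M A app"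
  by (auto simp: hom_def computable_mcat_def computable_def)

lemma composable_computable_mcat:
  "composable N f gs \<longleftrightarrow>
    composable M f gs \<and> f \<in> computable M A app \<and> set gs \<subseteq> computable M A app"
  by (auto simp: composable_def computable_mcat_def computable_def hom_def)

text \<open>The operations are those of \<open>M\<close>, so all laws are inherited. Only closure
  needs an argument; it is kept as a hypothesis, to be supplied by combinatory completeness.\<close>

lemma multicategory_computable_mcat:
  assumes idn: "idn M A \<in> computable M A app"
    and cmp: "\<And>f gs. composable M f gs \<Longrightarrow> f \<in> computable M A app \<Longrightarrow>
      set gs \<subseteq> computable M A app \<Longrightarrow> cmp M f gs \<in> computable M A app"
  shows "multicategory N"
proof
  have sel: "Obj N = {A}" "Mor N = computable M A app" "src N = src M" "tgt N = tgt M"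
    "idn N = idn M" "cmp N = cmp M"
    by (simp_all add: computable_mcat_def)
  have Mor: "f \<in> Mor M" if "f \<in> computable M A app" for f
    using that by (auto simp: computable_def hom_def)
  show "set (src N f) \<subseteq> Obj N" "tgt N f \<in> Obj N" if "f \<in> Mor N" for f
    using that by (auto simp: sel hom_def elim!: computableE)
  show "idn N B \<in> hom N [B] B" if "B \<in> Obj N" for B
    using that idn idn_hom[OF A_Obj] by (auto simp: hom_computable_mcat sel)
  show "cmp N f gs \<in> hom N (concat (map (src N) gs)) (tgt N f)" if "composable N f gs" for f gs
    using that cmp_hom[of f gs] cmp[of f gs]
    by (auto simp: hom_computable_mcat composable_computable_mcat sel)
  show "cmp N f (map (idn N) (src N f)) = f" "cmp N (idn N (tgt N f)) [f] = f"
    if "f \<in> Mor N" for f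
    using that Mor cmp_idn_right cmp_idn_left by (auto simp: sel)
  show "cmp N (cmp N f gs) (concat hss) = cmp N f (map2 (cmp N) gs hss)"
    if "composable N f gs" "list_all2 (composable N) gs hss" for f gs hss
  proof -
    have "list_all2 (composable M) gs hss"
      using that(2) by (rule list_all2_mono) (simp add: composable_computable_mcat)
    then show ?thesis
      using that(1) cmp_assoc by (simp add: composable_computable_mcat sel)
  qed
qed

text \<open>The internal hom and the evaluation are constant functions because \<open>A\<close> is
  the only object.\<close>

lemma closed_computable_mcat:
  assumes "multicategory N" and app: "app \<in> computable M A app"
    and ext: "multi_extensional M A app"
  shows "closed_multicategory N (\<lambda>_ _. A) (\<lambda>_ _. app)"
proof -
  interpret N: multicategory N by fact
  show ?thesis
  proof
    fix B C \<Gamma> f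
    assume Obj: "B \<in> Obj N" "C \<in> Obj N"
    then have [simp]: "B = A" "C = A"
      by (auto simp: computable_mcat_def)
    show "A \<in> Obj N"
      using Obj by simp
    show "app \<in> hom N [A, B] C"
      using app app_hom by (simp add: hom_computable_mcat)
    assume \<Gamma>: "set \<Gamma> \<subseteq> Obj N" and f: "f \<in> hom N (\<Gamma> @ [B]) C"
    have \<Gamma>_eq: "\<Gamma> = replicate (length \<Gamma>) A"
      using \<Gamma> by (intro replicate_eqI) (auto simp: computable_mcat_def)
    \<comment> \<open>The source \<open>\<Gamma> @ [A]\<close> has one entry more than \<Gamma>, so
      the code \<open>a\<close> is taken at arity \<open>Suc (length \<Gamma>)\<close>.\<close>
    obtain a where a: "a \<in> hom M [] A" "f = app_element M A app (Suc (length \<Gamma>)) a"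
      using f computable_homE[of f "\<Gamma> @ [A]" A] by (auto simp: hom_computable_mcat)
    show "\<exists>!h. h \<in> hom N \<Gamma> A \<and> cmp N app [h, idn N B] = f"
    proof
      \<comment> \<open>Existence: the transpose has the same code \<open>a\<close>, used at one
        arity less.\<close>
      show "app_element M A app (length \<Gamma>) a \<in> hom N \<Gamma> A \<and>
          cmp N app [app_element M A app (length \<Gamma>) a, idn N B] = f"
        using app_element_hom[OF a(1), of "length \<Gamma>"] app_element_computable[OF a(1)]
          app_element_Suc[OF a(1)] a(2) \<Gamma>_eq
        by (simp add: hom_computable_mcat) (simp add: computable_mcat_def)
      fix h
      assume h: "h \<in> hom N \<Gamma> A \<and> cmp N app [h, idn N B] = f"
      then obtain b where b: "b \<in> hom M [] A" "h = app_element M A app (length \<Gamma>) b"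
        using computable_homE[of h \<Gamma> A] by (auto simp: hom_computable_mcat)
      \<comment> \<open>Uniqueness: a code \<open>b\<close> of any transpose \<open>h\<close> also
        codes \<open>f\<close>, so multi-extensionality at arity
        \<open>Suc (length \<Gamma>)\<close> identifies it with \<open>a\<close>.\<close>
      have "app_element M A app (Suc (length \<Gamma>)) b = app_element M A app (Suc (length \<Gamma>)) a"
        using h a(2) b app_element_Suc[OF b(1)] by (simp add: computable_mcat_def)
      then show "h = app_element M A app (length \<Gamma>) a"
        using ext a(1) b unfolding multi_extensional_def by blast
    qed
  qed
qed

text \<open>Uniqueness of transposes cancels one outer \<open>app\<close> at a time, so an equation
  between coded morphisms descends to arity 0.\<close>

lemma multi_extensional_if_closed:
  assumes "closed_multicategory N (\<lambda>_ _. A) (\<lambda>_ _. app)"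
  shows "multi_extensional M A app"
proof -
  interpret N: closed_multicategory N "\<lambda>_ _. A" "\<lambda>_ _. app" by fact
  have "a = b" if a: "a \<in> hom M [] A" and b: "b \<in> hom M [] A"
    and "app_element M A app n a = app_element M A app n b" for n a b
    using that(3)
  proof (induction n)
    case 0
    then show ?case using app_element_0 a b by simp
  next
    case (Suc n)
    have eq: "cmp N app [app_element M A app n a, idn N A] =
        cmp N app [app_element M A app n b, idn N A]"
      using Suc.prems app_element_Suc a b by (simp add: computable_mcat_def)
    have hom: "app_element M A app n c \<in> hom N (replicate n A) A" if "c \<in> hom M [] A" for c
      using that by (simp add: hom_computable_mcat app_element_hom app_element_computable)
    have Obj: "A \<in> Obj N" "set (replicate n A) \<subseteq> Obj N"
      by (auto simp: computable_mcat_def)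
    \<comment> \<open>The universal property is stated for morphisms of \<open>N\<close>, so this
      composite must be computable: it is the morphism of arity \<open>Suc n\<close> coded by
      \<open>a\<close>.\<close>
    have "cmp N app [app_element M A app n a, idn N A] \<in> hom N (replicate n A @ [A]) A"
      using app_cmp_hom[OF app_element_hom[OF a]] app_element_computable[OF a, of "Suc n"]
        app_element_Suc[OF a, of n]
      by (simp add: hom_computable_mcat) (simp add: computable_mcat_def)
    \<comment> \<open>Both morphisms of arity \<open>n\<close> are transposes of this one composite,
      hence equal.\<close>
    from N.ev_universal[OF Obj(1) Obj(1) Obj(2) this]
    have "app_element M A app n a = app_element M A app n b"
      using eq hom[OF a] hom[OF b] by metis
    then show ?case by (rule Suc.IH)
  qed
  then show ?thesis by (auto simp: multi_extensional_def)
qed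

end

text \<open>Every \<open>F\<close> in the intersection contains \<open>generated S M A app\<close>,
  hence \<open>f\<close> and \<open>gs\<close>, and is itself closed under composition.\<close>

lemma cmp_generated:
  assumes "composable M f gs" "f \<in> generated S M A app" "set gs \<subseteq> generated S M A app"
  shows "cmp M f gs \<in> generated S M A app"
  unfolding generated_def
proof (rule InterI, clarify)
  fix F X
  assume F: "sub_S_multicategory S M X F" "app \<in> F" "hom M [] A \<subseteq> F"
  then have "generated S M A app \<subseteq> F"
    by (auto simp: generated_def)
  then have "f \<in> F" "set gs \<subseteq> F"
    using assms(2,3) by auto
  then show "cmp M f gs \<in> F"
    using F(1) assms(1) by (simp add: sub_S_multicategory_def)
qed

lemma app_generated: "app \<in> generated S M A app"
  by (auto simp: generated_def)

lemma element_generated: "a \<in> hom M [] A \<Longrightarrow> a \<in> generated S M A app"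
  by (auto simp: generated_def)

text \<open>Each competing \<open>F\<close> contains \<open>app\<close>, whose target is
  \<open>A\<close>; so \<open>A\<close> lies in the object part \<open>X\<close>, and its identity
  in \<open>F\<close>.\<close>

lemma idn_generated:
  assumes "applicative_system M A app"
  shows "idn M A \<in> generated S M A app"
  using assms by (auto simp: generated_def sub_S_multicategory_def applicative_system_def hom_def)

theorem theorem5p8:
  fixes S :: "fmor set" and M :: "('o, 'm, 'x) smcat_scheme" and A :: 'o and app :: 'm
  assumes "faithful_cartesian_club S"
    and "S_multicategory S M"
    and "applicative_system M A app"
    and "combinatory_complete S M A app"
  shows "multi_extensional M A app \<longleftrightarrow>
    closed_multicategory (computable_mcat M A app) (\<lambda>_ _. A) (\<lambda>_ _. app)"
proof -
  interpret S_multicategory S M by fact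
  interpret applicative M A app by unfold_locales fact
  let ?G = "generated S M A app"
  \<comment> \<open>The inclusion of the computable morphisms in \<open>?G\<close>: powers of
    \<open>app\<close>, and then coded morphisms, are composites of \<open>app\<close>, identities
    and elements.\<close>
  have app_pow: "app_pow M A app n \<in> ?G" for n
  proof (induction n)
    case 0
    then show ?case using idn_generated[OF assms(3)] by simp
  next
    case (Suc n)
    then show ?case
      using cmp_generated[OF app_composable[OF app_pow_hom]]
      by (simp add: app_generated idn_generated[OF assms(3)])
  qed
  have "app_element M A app n a \<in> ?G" if "a \<in> hom M [] A" for n a
    unfolding app_element_def
    by (rule cmp_generated[OF app_element_composable[OF that] app_pow])
      (auto simp: element_generated[OF that] idn_generated[OF assms(3)])
  then have "computable M A app \<subseteq> ?G"
    by (auto elim!: computableE)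
  \<comment> \<open>Completeness is the other inclusion. With equality, the closure properties of
    \<open>?G\<close>, and \<open>app\<close> as a member, pass to the computable morphisms.\<close>
  with assms(4) have G: "computable M A app = ?G"
    by (auto simp: combinatory_complete_def)
  have "multicategory N"
    by (rule multicategory_computable_mcat) (simp_all add: G cmp_generated idn_generated[OF assms(3)])
  then show ?thesis
    using closed_computable_mcat multi_extensional_if_closed app_generated[of app S M A] G by blast
qed

end
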